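(* Let $p\ge1$, let $\varphi:\mathbb{R}^n\times\mathbb{R}^{n_1}\times\dots\times\mathbb{R}^{n_p}\to\mathbb{R}^n$ be Lipschitz continuous in each of its arguments with constants $L_i$ ($i=0,\dots,p$), and let the solution maps $(\mathbf{x},\mathbf{u}_1,\dots,\mathbf{u}_{i-1})\mapsto\mathbf{u}_i$ be Lipschitz continuous with respect to each of their arguments with constants $K_{i,j}$ ($i=1,\dots,p$, $j=0,\dots,i-1$). Suppose that $K_{i,j}\le\kappa$ and $L_i\le\lambda$ for all indices. If any of the following conditions holds: 1. $\lambda(\kappa+1)^p<1$; 2. $\varphi$ is a Picard solver and $\kappa<2^{1/p}-1$; 3. $\mathcal{K}$ is linearly structured and $\dfrac{\kappa^{p+1}-\kappa}{\kappa-1}<\dfrac{1-\lambda}{\lambda}$ (with $\kappa\ne1$ and $\lambda>0$); 4. $\varphi$ is a Picard solver, $\mathcal{K}$ is linearly structured, $\kappa<1$ and $\kappa^{p+1}-2\kappa+1>0$ (in particular, $\kappa<\frac12$ satisfies these constraints on $\kappa$); 5. $\varphi$ is a weak Picard solver, $\mathcal{K}$ is linearly structured and $\prod_{i=1}^pK_{i,i-1}<1$; then $G(\mathbf{x})=\varphi(\mathbf{x},\mathbf{u}_1,\dots,\mathbf{u}_p)$ is a contraction.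
   Context: For $i=1,\dots,p$, the vector $\mathbf{u}_i\in\mathbb{R}^{n_i}$ is the solution of a linear system whose data depend on $\mathbf{x}\in\mathbb{R}^n$ and on the previous solutions: $\mathbf{u}_i=A_i^{-1}F_i$, with $A_i=A_i(\mathbf{x},\mathbf{u}_1,\dots,\mathbf{u}_{i-1})\in\mathrm{GL}_{n_i}(\mathbb{R})$ and $F_i=F_i(\mathbf{x},\mathbf{u}_1,\dots,\mathbf{u}_{i-1})\in\mathbb{R}^{n_i}$. This defines the solution maps $(\mathbf{x},\mathbf{u}_1,\dots,\mathbf{u}_{i-1})\mapsto\mathbf{u}_i$. In $G(\mathbf{x})=\varphi(\mathbf{x},\mathbf{u}_1,\dots,\mathbf{u}_p)$ the $\mathbf{u}_i$ are computed recursively from $\mathbf{x}$: $\mathbf{u}_1=\mathbf{u}_1(\mathbf{x})$, $\mathbf{u}_2=\mathbf{u}_2(\mathbf{x},\mathbf{u}_1)$, etc. Norms are Euclidean. "Lipschitz continuous in an argument with constant $c\ge0$" means $c$-Lipschitz in that argument when the others are held fixed, uniformly over the values of the others; $L_0$ and $K_{i,0}$ refer to the argument $\mathbf{x}$, and $L_i$ ($i\ge1$), $K_{i,j}$ ($j\ge1$) to the arguments $\mathbf{u}_i$, $\mathbf{u}_j$ respectively. A contraction is a map that is $L$-Lipschitz for some $L<1$. Picard solver: $\varphi(\mathbf{x},\mathbf{u}_1,\dots,\mathbf{u}_p)=(\mathbf{u}_1,\dots,\mathbf{u}_p)$ (so $n=n_1+\dots+n_p$), with $L_0=0$ and $L_i=1$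 for $i>0$. Weak Picard solver: $\varphi(\mathbf{x},\mathbf{u}_1,\dots,\mathbf{u}_p)=\mathbf{u}_p$ (so $n=n_p$), with $L_p=1$ and $L_i=0$ for $0\le i<p$. $\mathcal{K}$ is the dependence structure matrix with entries $(\mathcal{K})_{ij}=K_{i,j}$ ($i=1,\dots,p$, $j=0,\dots,i-1$); it is linearly structured if it has strictly positive elements on its subdiagonal and zeros elsewhere, i.e. $K_{i,j}>0\iff j=i-1$. *)

theory Defs
  imports
    "Jordan_Normal_Form.Gauss_Jordan_Elimination"
    "HOL-Analysis.L2_Norm"
    "HOL-Library.FuncSet"
begin

definition vnorm :: "real vec \<Rightarrow> real" where
  "vnorm v = L2_set (\<lambda>k. v $ k) {..<dim_vec v}"

(* The arguments x, u_1, u_2, ... have indices 0, 1, 2, ...; the dimension of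
   argument i is d i, so that d 0 is n and d i is n_i for i > 0.
   An element of tuples d {..<i} is a tuple (x, u_1, ..., u_(i-1)). Since such functions
   are undefined outside the index set, a map applied to one depends on these entries only. *)
definition tuples :: "(nat \<Rightarrow> nat) \<Rightarrow> nat set \<Rightarrow> (nat \<Rightarrow> real vec) set" where
  "tuples d I = (\<Pi>\<^sub>E i\<in>I. carrier_vec (d i))"

(* The bound is uniform in the values of the arguments other than j. *)
definition lipschitz_in_arg ::
  "(nat \<Rightarrow> nat) \<Rightarrow> nat set \<Rightarrow> nat \<Rightarrow> real \<Rightarrow> ((nat \<Rightarrow> real vec) \<Rightarrow> real vec) \<Rightarrow> bool" where
  "lipschitz_in_arg d I j c f \<longleftrightarrow> 0 \<le> c \<and>
     (\<forall>v\<in>tuples d I. \<forall>w\<in>carrier_vec (d j). vnorm (f (v(j := w)) - f v) \<le> c * vnorm (w - v j))"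

definition contraction :: "nat \<Rightarrow> (real vec \<Rightarrow> real vec) \<Rightarrow> bool" where
  "contraction n f \<longleftrightarrow> f \<in> carrier_vec n \<rightarrow> carrier_vec n \<and>
     (\<exists>c. 0 \<le> c \<and> c < 1 \<and>
       (\<forall>x\<in>carrier_vec n. \<forall>y\<in>carrier_vec n. vnorm (f x - f y) \<le> c * vnorm (x - y)))"

(* mat_inverse returns Some inverse exactly for invertible matrices *)
definition solution_map ::
  "(nat \<Rightarrow> (nat \<Rightarrow> real vec) \<Rightarrow> real mat) \<Rightarrow> (nat \<Rightarrow> (nat \<Rightarrow> real vec) \<Rightarrow> real vec) \<Rightarrow>
   nat \<Rightarrow> (nat \<Rightarrow> real vec) \<Rightarrow> real vec" where
  "solution_map A F i v = the (mat_inverse (A i v)) *\<^sub>v F i v"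

(* The tuple (x, u_1, ..., u_i) with every u_k computed from x and the preceding u's. *)
primrec solutions ::
  "(nat \<Rightarrow> (nat \<Rightarrow> real vec) \<Rightarrow> real mat) \<Rightarrow> (nat \<Rightarrow> (nat \<Rightarrow> real vec) \<Rightarrow> real vec) \<Rightarrow>
   real vec \<Rightarrow> nat \<Rightarrow> (nat \<Rightarrow> real vec)" where
  "solutions A F x 0 = (\<lambda>_. undefined)(0 := x)"
| "solutions A F x (Suc i) =
     (solutions A F x i)(Suc i := solution_map A F (Suc i) (solutions A F x i))"

definition G_map ::
  "nat \<Rightarrow> ((nat \<Rightarrow> real vec) \<Rightarrow> real vec) \<Rightarrow>
   (nat \<Rightarrow> (nat \<Rightarrow> real vec) \<Rightarrow> real mat) \<Rightarrow> (nat \<Rightarrow> (nat \<Rightarrow> real vec) \<Rightarrow> real vec) \<Rightarrow>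
   real vec \<Rightarrow> real vec" where
  "G_map p \<phi> A F x = \<phi> (solutions A F x p)"

(* (u_1, ..., u_i) as one vector of dimension n_1 + ... + n_i *)
primrec stacked :: "nat \<Rightarrow> (nat \<Rightarrow> real vec) \<Rightarrow> real vec" where
  "stacked 0 v = vNil"
| "stacked (Suc i) v = stacked i v @\<^sub>v v (Suc i)"

definition picard_solver ::
  "(nat \<Rightarrow> nat) \<Rightarrow> nat \<Rightarrow> (nat \<Rightarrow> real) \<Rightarrow> ((nat \<Rightarrow> real vec) \<Rightarrow> real vec) \<Rightarrow> bool" where
  "picard_solver d p L \<phi> \<longleftrightarrow> d 0 = (\<Sum>i=1..p. d i) \<and>
     (\<forall>v\<in>tuples d {..p}. \<phi> v = stacked p v) \<and> L 0 = 0 \<and> (\<forall>i\<in>{1..p}. L i = 1)"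

definition weak_picard_solver ::
  "(nat \<Rightarrow> nat) \<Rightarrow> nat \<Rightarrow> (nat \<Rightarrow> real) \<Rightarrow> ((nat \<Rightarrow> real vec) \<Rightarrow> real vec) \<Rightarrow> bool" where
  "weak_picard_solver d p L \<phi> \<longleftrightarrow> d 0 = d p \<and>
     (\<forall>v\<in>tuples d {..p}. \<phi> v = v p) \<and> L p = 1 \<and> (\<forall>i<p. L i = 0)"

(* K i j is the entry in row i = 1, ..., p and column j = 0, ..., i - 1; columns are counted
   from 0, so the subdiagonal is j = i - 1. *)
definition linearly_structured :: "nat \<Rightarrow> (nat \<Rightarrow> nat \<Rightarrow> real) \<Rightarrow> bool" where
  "linearly_structured p K \<longleftrightarrow>
     (\<forall>i\<in>{1..p}. \<forall>j<i. if j = i - 1 then K i j > 0 else K i j = 0)"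

end

theory Submission
  imports Defs
begin

text \<open>
  Fix two inputs \<open>x\<close> and \<open>y\<close> and let \<open>e i\<close> be the distance between the two \<open>i\<close>-th components
  of the recursively computed tuples, so \<open>e 0\<close> is the distance of \<open>x\<close> and \<open>y\<close>. Changing the
  arguments of a map one at a time turns Lipschitz continuity in each argument into a bound by
  the weighted sum of the argument distances (\<open>lipschitz_in_args_imp_sum_bound\<close>). Applied to the
  solution maps it gives the linear recursion \<open>e i \<le> (\<Sum>j<i. K i j * e j)\<close>, and applied to
  \<open>\<phi>\<close> it bounds the distance of the two values of \<open>G\<close> by \<open>\<Sum>i\<le>p. L i * e i\<close>.

  What remains concerns real sequences. In general the partial sums of \<open>e\<close> grow by a factor of at
  most \<open>\<kappa> + 1\<close> per step (\<open>sum_le_power_of_recursion\<close>). For a linearly structured matrix the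
  recursion has a single term, so \<open>e i\<close> is at most \<open>e 0\<close> times a product of subdiagonal
  entries, hence at most \<open>\<kappa> ^ i * e 0\<close>, and the sums are geometric. A Picard solver drops the
  summand \<open>e 0\<close> and a weak Picard solver keeps only \<open>e p\<close>. Each of the five conditions states
  that the factor of \<open>e 0\<close> obtained in this way is less than \<open>1\<close>.
\<close>

section \<open>Functions that are Lipschitz in each argument\<close>

lemma vnorm_nonneg: "0 \<le> vnorm v"
  by (simp add: vnorm_def)

lemma vnorm_diff_triangle:
  assumes "a \<in> carrier_vec n" "b \<in> carrier_vec n" "c \<in> carrier_vec n"
  shows "vnorm (a - c) \<le> vnorm (a - b) + vnorm (b - c)"
proof -
  have "vnorm (a - c) = L2_set (\<lambda>k. (a - b) $ k + (b - c) $ k) {..<n}"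
    unfolding vnorm_def using assms by (intro L2_set_cong) auto
  also have "\<dots> \<le> L2_set (\<lambda>k. (a - b) $ k) {..<n} + L2_set (\<lambda>k. (b - c) $ k) {..<n}"
    by (rule L2_set_triangle_ineq)
  also have "\<dots> = vnorm (a - b) + vnorm (b - c)"
    using assms by (simp add: vnorm_def)
  finally show ?thesis .
qed

text \<open>
  The arguments in \<open>I\<close> are changed from \<open>w\<close> to \<open>v\<close> one after the other. The intermediate points
  are again tuples, and the Lipschitz constants are uniform in the arguments held fixed, so the
  triangle inequality adds up the single steps.
\<close>
lemma lipschitz_in_args_imp_sum_bound:
  assumes fin: "finite I"
    and f: "f \<in> tuples d I \<rightarrow> carrier_vec m"
    and lip: "\<And>j. j \<in> I \<Longrightarrow> lipschitz_in_arg d I j (c j) f"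
    and v: "v \<in> tuples d I" and w: "w \<in> tuples d I"
  shows "vnorm (f v - f w) \<le> (\<Sum>j\<in>I. c j * vnorm (v j - w j))"
proof -
  define h where "h J = (\<lambda>i. if i \<in> J then v i else w i)" for J
  have h_tuple: "h J \<in> tuples d I" for J
    using v w by (auto simp: h_def tuples_def PiE_iff extensional_def)
  have "vnorm (f (h J) - f w) \<le> (\<Sum>j\<in>J. c j * vnorm (v j - w j))" if "J \<subseteq> I" for J
    using finite_subset[OF that fin] that
  proof (induction J)
    case empty
    have "f w \<in> carrier_vec m" using f w by auto
    then have "f w - f w = 0\<^sub>v m" by simp
    then show ?case by (simp add: h_def vnorm_def L2_set_def)
  next
    case (insert j J)
    have step: "h (insert j J) = (h J)(j := v j)" by (auto simp: h_def)
    have "v j \<in> carrier_vec (d j)" using v insert.prems by (auto simp: tuples_def)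
    then have "vnorm (f (h (insert j J)) - f (h J)) \<le> c j * vnorm (v j - h J j)"
      using lip[of j] h_tuple[of J] insert.prems unfolding step lipschitz_in_arg_def by blast
    also have "h J j = w j" using insert.hyps by (simp add: h_def)
    finally have one: "vnorm (f (h (insert j J)) - f (h J)) \<le> c j * vnorm (v j - w j)" .
    have "vnorm (f (h (insert j J)) - f w)
        \<le> vnorm (f (h (insert j J)) - f (h J)) + vnorm (f (h J) - f w)"
      using f h_tuple w by (intro vnorm_diff_triangle[of _ m]) blast+
    with one insert show ?case by simp
  qed
  moreover have "h I = v"
    using v w by (auto simp: h_def tuples_def PiE_iff extensional_def fun_eq_iff)
  ultimately show ?thesis by (metis order_refl)
qed

section \<open>Recursively computed solutions\<close>

text \<open>
  The partial function \<open>mat_inverse\<close> is characterised by the units of the matrix ring, so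
  \<open>invertible_mat\<close> has to be translated to that notion before \<open>the\<close> is known to return an
  actual inverse.
\<close>
lemma solution_map_in_carrier:
  assumes "A i v \<in> carrier_mat n n" "invertible_mat (A i v)" "F i v \<in> carrier_vec n"
  shows "solution_map A F i v \<in> carrier_vec n"
proof -
  obtain B where "mat_inverse (A i v) = Some B"
  proof (cases "mat_inverse (A i v)")
    case None
    obtain C where C: "inverts_mat (A i v) C" "inverts_mat C (A i v)"
      using assms(2) unfolding invertible_mat_def by blast
    (* The defining equations of an inverse also determine its dimensions. *)
    have "A i v * C = 1\<^sub>m n" "C * A i v = 1\<^sub>m (dim_row C)"
      using C assms(1) by (auto simp: inverts_mat_def)
    from this[THEN arg_cong[where f = dim_col]] have "dim_col C = n" "dim_row C = n"
      using assms(1) by auto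
    then have "C \<in> carrier_mat n n" by auto
    then have "A i v \<in> Units (ring_mat TYPE(real) n ())"
      using C assms(1) by (auto simp: Units_def ring_mat_def inverts_mat_def)
    with mat_inverse(1)[OF assms(1) None, of "()"] show ?thesis by blast
  qed auto
  with mat_inverse(2)[OF assms(1)] assms(3) show ?thesis
    by (auto simp: solution_map_def)
qed

lemma solutions_in_tuples:
  assumes "\<And>i v. i \<in> {1..p} \<Longrightarrow> v \<in> tuples d {..<i} \<Longrightarrow> solution_map A F i v \<in> carrier_vec (d i)"
    and "x \<in> carrier_vec (d 0)" and "i \<le> p"
  shows "solutions A F x i \<in> tuples d {..i}"
  using assms(3)
proof (induction i)
  case 0
  then show ?case using assms(2) by (auto simp: tuples_def PiE_iff extensional_def)
next
  case (Suc i)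
  then have IH: "solutions A F x i \<in> tuples d {..i}" by simp
  then have "solution_map A F (Suc i) (solutions A F x i) \<in> carrier_vec (d (Suc i))"
    using assms(1)[of "Suc i"] Suc.prems by (simp add: lessThan_Suc_atMost)
  with IH show ?case
    by (auto simp: tuples_def PiE_iff extensional_def le_Suc_eq)
qed

text \<open>
  Later steps do not alter earlier components, so all distances can be read off from the two
  complete tuples.
\<close>
lemma solutions_component_stable: "j \<le> i \<Longrightarrow> solutions A F x i j = solutions A F x j j"
  by (induction i) (auto simp: le_Suc_eq)

lemma solutions_distance_recursion:
  assumes sol: "\<And>i v. i \<in> {1..p} \<Longrightarrow> v \<in> tuples d {..<i} \<Longrightarrow>
      solution_map A F i v \<in> carrier_vec (d i)"
    and lip: "\<And>i j. i \<in> {1..p} \<Longrightarrow> j < i \<Longrightarrow>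
      lipschitz_in_arg d {..<i} j (K i j) (solution_map A F i)"
    and x: "x \<in> carrier_vec (d 0)" and y: "y \<in> carrier_vec (d 0)"
    and i: "i \<in> {1..p}"
  shows "vnorm (solutions A F x p i - solutions A F y p i)
    \<le> (\<Sum>j<i. K i j * vnorm (solutions A F x p j - solutions A F y p j))"
proof -
  obtain k where k: "i = Suc k" "k < p" using i by (cases i) auto
  have tup: "solutions A F z k \<in> tuples d {..<i}" if "z \<in> carrier_vec (d 0)" for z
    using solutions_in_tuples[OF sol that, of p k] k by (simp add: lessThan_Suc_atMost)
  have last: "solutions A F z p i = solution_map A F i (solutions A F z k)" for z
    using solutions_component_stable[of i p A F z] k by simp
  have prev: "solutions A F z p j = solutions A F z k j" if "j < i" for z j
    using solutions_component_stable[of j p A F z] solutions_component_stable[of j k A F z]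
      that k by simp
  have "vnorm (solution_map A F i (solutions A F x k) - solution_map A F i (solutions A F y k))
      \<le> (\<Sum>j<i. K i j * vnorm (solutions A F x k j - solutions A F y k j))"
    by (rule lipschitz_in_args_imp_sum_bound[where m = "d i"])
      (use sol lip i tup x y in auto)
  then show ?thesis by (simp add: last prev)
qed

section \<open>Growth of sequences bounded by their predecessors\<close>

text \<open>
  Adding \<open>e (Suc n)\<close> to a partial sum adds at most \<open>\<kappa>\<close> times that sum, which is the
  discrete Gronwall argument.
\<close>
lemma sum_le_power_of_recursion:
  fixes e :: "nat \<Rightarrow> real"
  assumes "0 \<le> \<kappa>" and "\<And>i. i < n \<Longrightarrow> e (Suc i) \<le> \<kappa> * (\<Sum>j\<le>i. e j)"
  shows "(\<Sum>j\<le>n. e j) \<le> (\<kappa> + 1) ^ n * e 0"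
  using assms(2)
proof (induction n)
  case 0
  then show ?case by simp
next
  case (Suc n)
  have "(\<Sum>j\<le>Suc n. e j) \<le> (\<kappa> + 1) * (\<Sum>j\<le>n. e j)"
    using Suc.prems[of n] by (simp add: algebra_simps)
  also have "\<dots> \<le> (\<kappa> + 1) * ((\<kappa> + 1) ^ n * e 0)"
    using Suc assms(1) by (intro mult_left_mono) auto
  finally show ?case by (simp add: mult.assoc)
qed

lemma le_prod_of_recursion:
  fixes e k :: "nat \<Rightarrow> real"
  assumes "\<And>i. i < n \<Longrightarrow> 0 \<le> k (Suc i)" and "\<And>i. i < n \<Longrightarrow> e (Suc i) \<le> k (Suc i) * e i"
  shows "e n \<le> (\<Prod>i=1..n. k i) * e 0"
  using assms
proof (induction n)
  case 0
  then show ?case by simp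
next
  case (Suc n)
  have "e (Suc n) \<le> k (Suc n) * e n" using Suc.prems(2) by simp
  also have "\<dots> \<le> k (Suc n) * ((\<Prod>i=1..n. k i) * e 0)"
    using Suc by (intro mult_left_mono) auto
  finally show ?case by (simp add: mult_ac)
qed

section \<open>Sufficient conditions for contraction\<close>

theorem corollary3p2:
  fixes p :: nat
    and d :: "nat \<Rightarrow> nat"
    and \<phi> :: "(nat \<Rightarrow> real vec) \<Rightarrow> real vec"
    and A :: "nat \<Rightarrow> (nat \<Rightarrow> real vec) \<Rightarrow> real mat"
    and F :: "nat \<Rightarrow> (nat \<Rightarrow> real vec) \<Rightarrow> real vec"
    and L :: "nat \<Rightarrow> real"
    and K :: "nat \<Rightarrow> nat \<Rightarrow> real"
    and \<kappa> lam :: real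
  assumes p: "p \<ge> 1"
    and A: "\<And>i v. i \<in> {1..p} \<Longrightarrow> v \<in> tuples d {..<i} \<Longrightarrow>
              A i v \<in> carrier_mat (d i) (d i) \<and> invertible_mat (A i v)"
    and F: "\<And>i v. i \<in> {1..p} \<Longrightarrow> v \<in> tuples d {..<i} \<Longrightarrow> F i v \<in> carrier_vec (d i)"
    and phi: "\<phi> \<in> tuples d {..p} \<rightarrow> carrier_vec (d 0)"
    and phi_lipschitz: "\<And>i. i \<le> p \<Longrightarrow> lipschitz_in_arg d {..p} i (L i) \<phi>"
    and solution_lipschitz: "\<And>i j. i \<in> {1..p} \<Longrightarrow> j < i \<Longrightarrow>
              lipschitz_in_arg d {..<i} j (K i j) (solution_map A F i)"
    and kappa: "\<And>i j. i \<in> {1..p} \<Longrightarrow> j < i \<Longrightarrow> K i j \<le> \<kappa>"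
    and lambda: "\<And>i. i \<le> p \<Longrightarrow> L i \<le> lam"
  shows "((lam * (\<kappa> + 1) ^ p < 1
           \<or> (picard_solver d p L \<phi> \<and> \<kappa> < 2 powr (1 / real p) - 1)
           \<or> (linearly_structured p K \<and> \<kappa> \<noteq> 1 \<and> lam > 0
               \<and> (\<kappa> ^ (p + 1) - \<kappa>) / (\<kappa> - 1) < (1 - lam) / lam)
           \<or> (picard_solver d p L \<phi> \<and> linearly_structured p K
               \<and> \<kappa> < 1 \<and> \<kappa> ^ (p + 1) - 2 * \<kappa> + 1 > 0)
           \<or> (weak_picard_solver d p L \<phi> \<and> linearly_structured p K
               \<and> (\<Prod>i=1..p. K i (i - 1)) < 1))
          \<longrightarrow> contraction (d 0) (G_map p \<phi> A F))
         \<and> (\<kappa> < 1 / 2 \<longrightarrow> \<kappa> < 1 \<and> \<kappa> ^ (p + 1) - 2 * \<kappa> + 1 > 0)"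
proof -
  have K_nonneg: "0 \<le> K i j" if "i \<in> {1..p}" "j < i" for i j
    using solution_lipschitz[OF that] by (simp add: lipschitz_in_arg_def)
  have L_nonneg: "0 \<le> L i" if "i \<le> p" for i
    using phi_lipschitz[OF that] by (simp add: lipschitz_in_arg_def)
  have kappa_nonneg: "0 \<le> \<kappa>" using K_nonneg[of 1 0] kappa[of 1 0] p by simp
  have lambda_nonneg: "0 \<le> lam" using L_nonneg[of 0] lambda[of 0] by simp
  have sol: "solution_map A F i v \<in> carrier_vec (d i)" if "i \<in> {1..p}" "v \<in> tuples d {..<i}" for i v
    using A[OF that] F[OF that] by (blast intro: solution_map_in_carrier)
  have tup: "solutions A F x p \<in> tuples d {..p}" if "x \<in> carrier_vec (d 0)" for x
    using solutions_in_tuples[OF sol that, of p p] by simp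
  define e where "e x y i = vnorm (solutions A F x p i - solutions A F y p i)" for x y i
  have e_nonneg: "0 \<le> e x y i" for x y i by (simp add: e_def vnorm_nonneg)
  have e_0: "e x y 0 = vnorm (x - y)" for x y
    using solutions_component_stable[of 0 p A F] by (simp add: e_def)
  have e_rec: "e x y i \<le> (\<Sum>j<i. K i j * e x y j)"
    if "x \<in> carrier_vec (d 0)" "y \<in> carrier_vec (d 0)" "i \<in> {1..p}" for x y i
    unfolding e_def
    by (rule solutions_distance_recursion[where d = d])
      (use sol solution_lipschitz that in auto)
  have G_bound: "vnorm (G_map p \<phi> A F x - G_map p \<phi> A F y) \<le> (\<Sum>i\<le>p. L i * e x y i)"
    if "x \<in> carrier_vec (d 0)" "y \<in> carrier_vec (d 0)" for x y
    unfolding e_def G_map_def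
    by (rule lipschitz_in_args_imp_sum_bound) (use phi phi_lipschitz tup that in auto)
  have contractionI: "contraction (d 0) (G_map p \<phi> A F)"
    if c: "0 \<le> c" "c < 1"
      and bound: "\<And>x y. x \<in> carrier_vec (d 0) \<Longrightarrow> y \<in> carrier_vec (d 0) \<Longrightarrow>
        (\<Sum>i\<le>p. L i * e x y i) \<le> c * e x y 0" for c
  proof -
    have "G_map p \<phi> A F \<in> carrier_vec (d 0) \<rightarrow> carrier_vec (d 0)"
      using phi tup by (auto simp: G_map_def)
    moreover have "vnorm (G_map p \<phi> A F x - G_map p \<phi> A F y) \<le> c * vnorm (x - y)"
      if "x \<in> carrier_vec (d 0)" "y \<in> carrier_vec (d 0)" for x y
      using G_bound[OF that] bound[OF that] by (simp add: e_0)
    ultimately show ?thesis using c unfolding contraction_def by blast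
  qed

  have general_L: "(\<Sum>i\<le>p. L i * e x y i) \<le> lam * (\<Sum>i\<le>p. e x y i)" for x y
    unfolding sum_distrib_left
    by (intro sum_mono mult_right_mono) (auto simp: lambda e_nonneg)
  have picard_L: "(\<Sum>i\<le>p. L i * e x y i) = (\<Sum>i\<le>p. e x y i) - e x y 0"
    if "picard_solver d p L \<phi>" for x y
  proof -
    have "L 0 = 0" "\<And>i. i \<in> {1..p} \<Longrightarrow> L i = 1" using that by (auto simp: picard_solver_def)
    then show ?thesis by (simp add: sum.atMost_shift)
  qed
  have weak_picard_L: "(\<Sum>i\<le>p. L i * e x y i) = e x y p"
    if "weak_picard_solver d p L \<phi>" for x y
    using that by (simp add: weak_picard_solver_def lessThan_Suc_atMost[symmetric])

  have general_sum: "(\<Sum>i\<le>p. e x y i) \<le> (\<kappa> + 1) ^ p * e x y 0"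
    if xy: "x \<in> carrier_vec (d 0)" "y \<in> carrier_vec (d 0)" for x y
  proof (rule sum_le_power_of_recursion[OF kappa_nonneg])
    fix i assume "i < p"
    then have "e x y (Suc i) \<le> (\<Sum>j<Suc i. K (Suc i) j * e x y j)"
      by (intro e_rec[OF xy]) simp
    also have "\<dots> \<le> (\<Sum>j<Suc i. \<kappa> * e x y j)"
      using kappa e_nonneg \<open>i < p\<close> by (intro sum_mono mult_right_mono) auto
    finally show "e x y (Suc i) \<le> \<kappa> * (\<Sum>j\<le>i. e x y j)"
      by (simp only: sum_distrib_left lessThan_Suc_atMost)
  qed
  have linear_rec: "e x y (Suc i) \<le> K (Suc i) i * e x y i"
    if lin: "linearly_structured p K" and xy: "x \<in> carrier_vec (d 0)" "y \<in> carrier_vec (d 0)"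
      and i: "i < p" for x y i
  proof -
    have "K (Suc i) j = 0" if "j < i" for j
      using lin i that by (auto simp: linearly_structured_def dest!: bspec[of _ _ "Suc i"])
    then show ?thesis using e_rec[OF xy, of "Suc i"] i by simp
  qed
  have linear_sum: "(\<Sum>i\<le>p. e x y i) \<le> (\<Sum>i\<le>p. \<kappa> ^ i) * e x y 0"
    if lin: "linearly_structured p K" and xy: "x \<in> carrier_vec (d 0)" "y \<in> carrier_vec (d 0)" for x y
  proof -
    have "e x y i \<le> \<kappa> ^ i * e x y 0" if "i \<le> p" for i
    proof -
      have "e x y i \<le> (\<Prod>j=1..i. \<kappa>) * e x y 0"
      proof (rule le_prod_of_recursion[OF kappa_nonneg])
        fix j assume "j < i"
        then have "e x y (Suc j) \<le> K (Suc j) j * e x y j" using linear_rec[OF lin xy] that by simp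
        also have "\<dots> \<le> \<kappa> * e x y j"
          using kappa[of "Suc j" j] \<open>j < i\<close> that e_nonneg by (intro mult_right_mono) auto
        finally show "e x y (Suc j) \<le> \<kappa> * e x y j" .
      qed
      then show ?thesis by simp
    qed
    then show ?thesis unfolding sum_distrib_right by (intro sum_mono) auto
  qed
  have power_sum: "(\<Sum>i\<le>p. \<kappa> ^ i) = 1 + (\<kappa> ^ (p + 1) - \<kappa>) / (\<kappa> - 1)" if "\<kappa> \<noteq> 1"
    using that by (simp add: sum_gp_strict lessThan_Suc_atMost[symmetric] divide_simps)
      (simp add: algebra_simps)

  have "contraction (d 0) (G_map p \<phi> A F)" if "lam * (\<kappa> + 1) ^ p < 1"
  proof (rule contractionI[OF _ that])
    fix x y :: "real vec" assume xy: "x \<in> carrier_vec (d 0)" "y \<in> carrier_vec (d 0)"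
    have "(\<Sum>i\<le>p. L i * e x y i) \<le> lam * ((\<kappa> + 1) ^ p * e x y 0)"
      using general_L general_sum[OF xy] lambda_nonneg by (meson mult_left_mono order_trans)
    then show "(\<Sum>i\<le>p. L i * e x y i) \<le> lam * (\<kappa> + 1) ^ p * e x y 0" by (simp add: mult.assoc)
  qed (use kappa_nonneg lambda_nonneg in simp)
  moreover have "contraction (d 0) (G_map p \<phi> A F)"
    if P: "picard_solver d p L \<phi>" and small: "\<kappa> < 2 powr (1 / real p) - 1"
  proof (rule contractionI[where c = "(\<kappa> + 1) ^ p - 1"])
    have "(\<kappa> + 1) ^ p < (2 powr (1 / real p)) ^ p"
      using small kappa_nonneg p by (intro power_strict_mono) auto
    also have "\<dots> = 2" using p by (simp add: powr_power)
    finally show "(\<kappa> + 1) ^ p - 1 < 1" by simp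
    show "0 \<le> (\<kappa> + 1) ^ p - 1" using kappa_nonneg by simp
  qed (use picard_L[OF P] general_sum in \<open>simp add: left_diff_distrib\<close>)
  moreover have "contraction (d 0) (G_map p \<phi> A F)"
    if lin: "linearly_structured p K" and "\<kappa> \<noteq> 1" "lam > 0"
      and small: "(\<kappa> ^ (p + 1) - \<kappa>) / (\<kappa> - 1) < (1 - lam) / lam"
  proof (rule contractionI[where c = "lam * (\<Sum>i\<le>p. \<kappa> ^ i)"])
    have "(\<Sum>i\<le>p. \<kappa> ^ i) < 1 + (1 - lam) / lam"
      using small power_sum[OF \<open>\<kappa> \<noteq> 1\<close>] by simp
    also have "\<dots> = 1 / lam" using \<open>lam > 0\<close> by (simp add: field_simps)
    finally show "lam * (\<Sum>i\<le>p. \<kappa> ^ i) < 1" using \<open>lam > 0\<close> by (simp add: field_simps)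
    show "0 \<le> lam * (\<Sum>i\<le>p. \<kappa> ^ i)"
      using kappa_nonneg lambda_nonneg by (intro mult_nonneg_nonneg sum_nonneg) auto
    fix x y :: "real vec" assume xy: "x \<in> carrier_vec (d 0)" "y \<in> carrier_vec (d 0)"
    have "(\<Sum>i\<le>p. L i * e x y i) \<le> lam * ((\<Sum>i\<le>p. \<kappa> ^ i) * e x y 0)"
      using general_L linear_sum[OF lin xy] lambda_nonneg by (meson mult_left_mono order_trans)
    then show "(\<Sum>i\<le>p. L i * e x y i) \<le> lam * (\<Sum>i\<le>p. \<kappa> ^ i) * e x y 0"
      by (simp add: mult.assoc)
  qed
  moreover have "contraction (d 0) (G_map p \<phi> A F)"
    if P: "picard_solver d p L \<phi>" and lin: "linearly_structured p K"
      and "\<kappa> < 1" and small: "\<kappa> ^ (p + 1) - 2 * \<kappa> + 1 > 0"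
  proof (rule contractionI[where c = "(\<Sum>i\<le>p. \<kappa> ^ i) - 1"])
    have "(\<kappa> ^ (p + 1) - \<kappa>) / (\<kappa> - 1) < 1"
      using \<open>\<kappa> < 1\<close> small by (simp add: divide_simps)
    then show "(\<Sum>i\<le>p. \<kappa> ^ i) - 1 < 1" using power_sum \<open>\<kappa> < 1\<close> by simp
    show "0 \<le> (\<Sum>i\<le>p. \<kappa> ^ i) - 1"
      using kappa_nonneg by (simp add: sum.atMost_shift sum_nonneg)
  qed (use picard_L[OF P] linear_sum[OF lin] in \<open>simp add: left_diff_distrib\<close>)
  moreover have "contraction (d 0) (G_map p \<phi> A F)"
    if W: "weak_picard_solver d p L \<phi>" and lin: "linearly_structured p K"
      and small: "(\<Prod>i=1..p. K i (i - 1)) < 1"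
  proof (rule contractionI[OF _ small])
    show "0 \<le> (\<Prod>i=1..p. K i (i - 1))" using K_nonneg by (intro prod_nonneg) auto
    fix x y :: "real vec" assume xy: "x \<in> carrier_vec (d 0)" "y \<in> carrier_vec (d 0)"
    have "e x y p \<le> (\<Prod>i=1..p. K i (i - 1)) * e x y 0"
      by (rule le_prod_of_recursion) (use K_nonneg linear_rec[OF lin xy] in auto)
    then show "(\<Sum>i\<le>p. L i * e x y i) \<le> (\<Prod>i=1..p. K i (i - 1)) * e x y 0"
      by (simp add: weak_picard_L[OF W])
  qed
  moreover have "\<kappa> < 1 \<and> \<kappa> ^ (p + 1) - 2 * \<kappa> + 1 > 0" if "\<kappa> < 1 / 2"
    using that zero_le_power[OF kappa_nonneg, of "p + 1"] by linarith
  ultimately show ?thesis by blast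
qed

end
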